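(* Let $d\ge 0$ and $k\ge 1$ be integers. The number $E_{d+k,d}$ of permutations of length $d+k$ having exactly $d$ descents is $$E_{d+k,d}=\sum_{\substack{a_1,a_2,\ldots,a_k\ge 1\\ a_1+a_2+\cdots+a_k=d+k}}(d+k)!\cdot\det\big(B(a_1,\ldots,a_k)\big),$$ where the sum is over $k$-tuples of integers and $B(a_1,\ldots,a_k)$ is the $k\times k$ matrix with entries $b_{i,j}$ ($1\le i,j\le k$) given by $$b_{i,j}=\frac{1}{(a_i+\cdots+a_j)!}\ \text{ when } i\le j,\qquad b_{i,i-1}=1,\qquad b_{i,j}=0\ \text{ when } i\ge j+2.$$
   Context: A descent of a permutation $\sigma=\sigma(1)\cdots\sigma(n)$ of $\{1,\dots,n\}$ is an index $i\in\{1,\dots,n-1\}$ with $\sigma(i)>\sigma(i+1)$. The numbers $E_{n,d}$ are the Eulerian numbers. *)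

theory Defs
  imports Complex_Main "HOL-Library.FuncSet" "HOL-Combinatorics.Permutations"
    "Jordan_Normal_Form.Determinant"
begin

definition descents :: "nat \<Rightarrow> (nat \<Rightarrow> nat) \<Rightarrow> nat set" where
  "descents n \<sigma> = {i \<in> {1..n - 1}. \<sigma> i > \<sigma> (i + 1)}"

definition eulerian :: "nat \<Rightarrow> nat \<Rightarrow> nat" where
  "eulerian n d = card {\<sigma>. \<sigma> permutes {1..n} \<and> card (descents n \<sigma>) = d}"

(* A k-tuple (a_1, ..., a_k) is an extensional function on {1..k}, so that distinct
   functions in this set are distinct tuples. *)
definition tuples :: "nat \<Rightarrow> nat \<Rightarrow> (nat \<Rightarrow> nat) set" where
  "tuples k n = {a \<in> {1..k} \<rightarrow>\<^sub>E {1..}. (\<Sum>i = 1..k. a i) = n}"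

definition b_entry :: "(nat \<Rightarrow> nat) \<Rightarrow> nat \<Rightarrow> nat \<Rightarrow> real" where
  "b_entry a i j =
    (if i \<le> j then 1 / fact (\<Sum>l = i..j. a l) else if i = j + 1 then 1 else 0)"

(* Matrices are indexed from 0, the entries b_entry a i j from 1. *)
definition B_mat :: "nat \<Rightarrow> (nat \<Rightarrow> nat) \<Rightarrow> real mat" where
  "B_mat k a = mat k k (\<lambda>(i, j). b_entry a (i + 1) (j + 1))"

end

theory Submission
  imports Defs "HOL-Combinatorics.Multiset_Permutations"
begin

text \<open>
  Write a permutation of \<open>{1..n}\<close> as a word and cut it between neighbours \<open>x < y\<close>, i.e. at its
  ascents. This leaves its maximal decreasing runs, and a permutation with \<open>r\<close> runs has \<open>n - r\<close>
  descents. Hence, for \<open>n = d + k\<close>, having \<open>d\<close> descents means having \<open>k\<close> runs, and the Eulerian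
  number splits as a sum over the possible sequences \<open>(a_1, ..., a_k)\<close> of run lengths, which are
  precisely the tuples in the claimed sum. It remains to prove MacMahon's formula: exactly
  \<open>n! det B(a_1, ..., a_k)\<close> permutations have the run lengths \<open>a_1, ..., a_k\<close>
  (lemma \<open>card_arrangements\<close>).

  Let \<open>N(a_1, ..., a_k)\<close> be the number of these permutations. Choose a set of \<open>a_1\<close> letters, write
  it down in decreasing order, and continue with any arrangement of the other letters that has run
  lengths \<open>a_2, ..., a_k\<close>. At the junction the word either ascends, and its run lengths are
  \<open>a_1, a_2, ..., a_k\<close>, or it descends, and they are \<open>a_1 + a_2, a_3, ..., a_k\<close>. Every word of these
  two kinds arises exactly once (lemma \<open>arrangements_split\<close>), so
    \<open>N(a_1, a_2, ..., a_k) + N(a_1 + a_2, a_3, ..., a_k) = (n choose a_1) N(a_2, ..., a_k)\<close>.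
  The determinant obeys the matching recursion (lemma \<open>det_B_mat_rec\<close>)
    \<open>det B(a_1, ..., a_k) = det B(a_2, ..., a_k) / a_1! - det B(a_1 + a_2, a_3, ..., a_k)\<close>,
  because the first column of \<open>B(a_1, ..., a_k)\<close> is \<open>(1 / a_1!, 1, 0, ..., 0)\<close>. Induction on \<open>k\<close>
  finishes the proof. In the recursion for \<open>N\<close> the remaining letters form an arbitrary set and not an
  initial segment, so the induction runs over words on all finite linearly ordered sets.
\<close>

section \<open>Decreasing runs of a word\<close>

text \<open>The lengths of the maximal strictly decreasing runs, from left to right. Equal neighbours would
  start a new run, but the words considered below have distinct letters.\<close>
fun run_lengths :: "'a::linorder list \<Rightarrow> nat list" where
  "run_lengths [] = []"
| "run_lengths [x] = [1]"
| "run_lengths (x # y # zs) =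
    (let r = run_lengths (y # zs) in if x > y then Suc (hd r) # tl r else 1 # r)"

lemma run_lengths_eq_Nil_iff [simp]: "run_lengths xs = [] \<longleftrightarrow> xs = []"
  by (cases xs rule: run_lengths.cases) (auto simp: Let_def)

lemma run_lengths_pos: "r \<in> set (run_lengths xs) \<Longrightarrow> r > 0"
proof (induction xs arbitrary: r rule: run_lengths.induct)
  case (3 x y zs)
  then show ?case
    by (cases "run_lengths (y # zs)") (auto simp: Let_def split: if_splits)
qed auto

lemma sum_list_run_lengths: "sum_list (run_lengths xs) = length xs"
proof (induction xs rule: run_lengths.induct)
  case (3 x y zs)
  then show ?case
    by (cases "run_lengths (y # zs)") (auto simp: Let_def)
qed auto

lemma card_descents_plus_runs:
  "card {i. Suc i < length xs \<and> xs ! i > xs ! Suc i} + length (run_lengths xs) = length xs"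
proof (induction xs rule: run_lengths.induct)
  case (3 x y zs)
  let ?D = "\<lambda>xs :: 'a list. {i. Suc i < length xs \<and> xs ! i > xs ! Suc i}"
  have fin: "finite (?D (y # zs))"
    by (rule finite_subset[of _ "{..<length (y # zs)}"]) auto
  have "?D (x # y # zs) = (if x > y then {0} else {}) \<union> Suc ` ?D (y # zs)"
  proof (rule Set.set_eqI)
    fix i
    show "i \<in> ?D (x # y # zs) \<longleftrightarrow> i \<in> (if x > y then {0} else {}) \<union> Suc ` ?D (y # zs)"
      by (cases i) (auto simp: image_iff)
  qed
  then have "card (?D (x # y # zs)) = (if x > y then 1 else 0) + card (?D (y # zs))"
    using fin by (simp add: card_image)
  with 3 show ?case
    by (cases "run_lengths (y # zs)") (auto simp: Let_def)
qed auto

text \<open>Putting a decreasing word in front of \<open>zs\<close> either adds a run of its own or lengthens the first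
  run of \<open>zs\<close>; which of the two happens depends only on the letters at the junction.\<close>
lemma run_lengths_append:
  assumes "sorted_wrt (>) ys" "ys \<noteq> []" "zs \<noteq> []"
  shows "run_lengths (ys @ zs) =
    (if last ys > hd zs then (length ys + hd (run_lengths zs)) # tl (run_lengths zs)
     else length ys # run_lengths zs)"
  using assms
proof (induction ys rule: run_lengths.induct)
  case (2 x)
  then show ?case by (cases zs) (auto simp: Let_def)
next
  case (3 x y ys)
  then show ?case by (auto simp: Let_def)
qed auto

text \<open>The converse of the previous lemma: cutting off a part of the first run leaves a word whose
  run lengths are known.\<close>
lemma run_lengths_drop:
  assumes "0 < m" "m \<le> hd (run_lengths xs)" "xs \<noteq> []"
  shows "sorted_wrt (>) (take m xs)"
    and "run_lengths (drop m xs) =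
      (if m < hd (run_lengths xs) then (hd (run_lengths xs) - m) # tl (run_lengths xs)
       else tl (run_lengths xs))"
proof -
  have "sorted_wrt (>) (take m xs) \<and> run_lengths (drop m xs) =
      (if m < hd (run_lengths xs) then (hd (run_lengths xs) - m) # tl (run_lengths xs)
       else tl (run_lengths xs))"
    using assms
  proof (induction xs arbitrary: m rule: run_lengths.induct)
    case (2 x)
    then show ?case by auto
  next
    case (3 x y zs)
    show ?case
    proof (cases "m = 1")
      case True
      then show ?thesis
        using run_lengths_pos[of "hd (run_lengths (y # zs))" "y # zs"]
        by (cases "run_lengths (y # zs)") (auto simp: Let_def)
    next
      case False
      with 3(2) obtain m' where m: "m = Suc (Suc m')"
        by (metis One_nat_def not0_implies_Suc not_gr_zero)
      \<comment> \<open>The first run has at least two letters, so it cannot stop after \<open>x\<close>.\<close>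
      with 3(3) have xy: "x > y"
        by (auto simp: Let_def split: if_splits)
      from 3(1)[of "Suc m'"] 3(3) m xy
      show ?thesis by (auto simp: Let_def)
    qed
  qed auto
  then show "sorted_wrt (>) (take m xs)"
    and "run_lengths (drop m xs) =
      (if m < hd (run_lengths xs) then (hd (run_lengths xs) - m) # tl (run_lengths xs)
       else tl (run_lengths xs))"
    by blast+
qed

text \<open>A decreasing word is determined by its set of letters, so choosing a decreasing prefix is the
  same as choosing a set.\<close>
lemma desc_sorted_unique:
  fixes xs :: "'a::linorder list"
  assumes "sorted_wrt (>) xs"
  shows "rev (sorted_list_of_set (set xs)) = xs"
proof -
  have "sorted_wrt (<) (rev xs)"
    using assms by (simp add: sorted_wrt_rev)
  then have "sorted_list_of_set (set xs) = rev xs"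
    by (intro strict_sorted_equal) auto
  then show ?thesis by simp
qed

section \<open>Arrangements with prescribed run lengths\<close>

definition arrangements :: "'a::linorder set \<Rightarrow> nat list \<Rightarrow> 'a list set" where
  "arrangements A as = {xs \<in> permutations_of_set A. run_lengths xs = as}"

lemma finite_arrangements [simp]: "finite (arrangements A as)"
  by (simp add: arrangements_def)

lemma card_arrangements_single:
  assumes "finite A" "card A = n" "n > 0"
  shows "card (arrangements A [n]) = 1"
proof -
  let ?d = "rev (sorted_list_of_set A)"
  have "xs = ?d" if "xs \<in> arrangements A [n]" for xs
  proof -
    from that have xs: "set xs = A" "distinct xs" "run_lengths xs = [n]"
      by (auto simp: arrangements_def permutations_of_set_def)
    have "length xs = n" using xs assms by (metis distinct_card)
    then have "sorted_wrt (>) xs"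
      using run_lengths_drop(1)[of n xs] xs assms by auto
    from desc_sorted_unique[OF this] xs show ?thesis by simp
  qed
  moreover have "?d \<in> arrangements A [n]"
  proof -
    have "run_lengths ys = [length ys]" if "sorted_wrt (>) ys" "ys \<noteq> []" for ys :: "'a list"
      using that by (induction ys rule: run_lengths.induct) (auto simp: Let_def)
    moreover have "A \<noteq> {}" using assms by auto
    ultimately show ?thesis
      using assms by (auto simp: arrangements_def permutations_of_set_def sorted_wrt_rev)
  qed
  ultimately have "arrangements A [n] = {?d}" by blast
  then show ?thesis by simp
qed

text \<open>The combinatorial recursion. The number \<open>p\<close> tells where a word of either kind has to be cut, so
  the pair \<open>(S, zs)\<close> is recovered as the letters of the prefix of length \<open>p\<close> and the remaining
  word.\<close>
lemma arrangements_split: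
  fixes A :: "'a::linorder set"
  assumes "finite A" "p > 0" "q > 0"
  shows "bij_betw (\<lambda>(S, zs). rev (sorted_list_of_set S) @ zs)
    (SIGMA S:{S. S \<subseteq> A \<and> card S = p}. arrangements (A - S) (q # as))
    (arrangements A (p # q # as) \<union> arrangements A ((p + q) # as))"
    (is "bij_betw ?f ?X ?Y")
proof (rule bij_betw_byWitness[where f' = "\<lambda>xs. (set (take p xs), drop p xs)"])
  show "\<forall>x\<in>?X. (set (take p (?f x)), drop p (?f x)) = x"
    using assms by (auto dest: finite_subset)
  have split: "sorted_wrt (>) (take p xs)" "run_lengths (drop p xs) = q # as"
    if "xs \<in> ?Y" for xs
  proof -
    from that have "xs \<noteq> []"
      by (auto simp: arrangements_def)
    with that assms run_lengths_drop[of p xs]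
    show "sorted_wrt (>) (take p xs)" "run_lengths (drop p xs) = q # as"
      by (auto simp: arrangements_def)
  qed
  show "\<forall>xs\<in>?Y. ?f (set (take p xs), drop p xs) = xs"
    using split desc_sorted_unique by fastforce
  show "?f ` ?X \<subseteq> ?Y"
  proof safe
    fix S zs
    assume S: "S \<subseteq> A" "p = card S" and zs: "zs \<in> arrangements (A - S) (q # as)"
      and notin: "rev (sorted_list_of_set S) @ zs \<notin> arrangements A ((card S + q) # as)"
    let ?ys = "rev (sorted_list_of_set S)"
    have fin: "finite S" using S assms finite_subset by blast
    have "?ys \<noteq> []" "zs \<noteq> []" "sorted_wrt (>) ?ys"
      using assms S zs fin by (auto simp: arrangements_def sorted_wrt_rev)
    from run_lengths_append[OF this(3,1,2)] S zs fin
    have "run_lengths (?ys @ zs) \<in> {p # q # as, (p + q) # as}"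
      by (auto simp: arrangements_def)
    moreover have "?ys @ zs \<in> permutations_of_set A"
      using S zs fin by (auto simp: arrangements_def permutations_of_set_def)
    ultimately show "?ys @ zs \<in> arrangements A (card S # q # as)"
      using notin S by (auto simp: arrangements_def)
  qed
  show "(\<lambda>xs. (set (take p xs), drop p xs)) ` ?Y \<subseteq> ?X"
  proof (rule image_subsetI)
    fix xs assume xs: "xs \<in> ?Y"
    then have perm: "set xs = A" "distinct xs"
      and hd: "p \<le> hd (run_lengths xs)" and ne: "run_lengths xs \<noteq> []"
      by (auto simp: arrangements_def permutations_of_set_def)
    have "hd (run_lengths xs) \<le> length xs"
      using ne member_le_sum_list[of "hd (run_lengths xs)" "run_lengths xs"] sum_list_run_lengths[of xs]
      by simp
    with hd have "p \<le> length xs" by simp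
    with perm have card: "card (set (take p xs)) = p"
      by (simp add: distinct_card)
    have sub: "set (take p xs) \<subseteq> A"
      using perm set_take_subset[of p xs] by simp
    have "set (drop p xs) = A - set (take p xs)"
    proof -
      have "set xs = set (take p xs) \<union> set (drop p xs)"
        by (metis append_take_drop_id set_append)
      moreover have "set (take p xs) \<inter> set (drop p xs) = {}"
        using perm by (simp add: set_take_disj_set_drop_if_distinct)
      ultimately show ?thesis using perm by blast
    qed
    then have "drop p xs \<in> arrangements (A - set (take p xs)) (q # as)"
      using split[OF xs] perm by (auto simp: arrangements_def permutations_of_set_def)
    with card sub show "(set (take p xs), drop p xs) \<in> ?X" by simp
  qed
qed

section \<open>The determinant recursion\<close>

lemma b_entry_cong:
  "(\<And>l. i \<le> l \<Longrightarrow> l \<le> j \<Longrightarrow> a l = a' l) \<Longrightarrow> b_entry a i j = b_entry a' i j"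
  by (auto simp: b_entry_def intro!: sum.cong arg_cong[where f = fact])

lemma B_mat_cong:
  assumes "\<And>l. 1 \<le> l \<Longrightarrow> l \<le> k \<Longrightarrow> a l = a' l"
  shows "B_mat k a = B_mat k a'"
  using assms by (auto simp: B_mat_def intro!: eq_matI b_entry_cong)

lemma b_entry_Suc: "b_entry a (Suc i) (Suc j) = b_entry (\<lambda>l. a (Suc l)) i j"
  by (simp add: b_entry_def sum.shift_bounds_cl_Suc_ivl del: sum.cl_ivl_Suc)

text \<open>Laplace expansion along the first column, whose only non-zero entries are the first two.
  Deleting the first row shifts the tuple by one. Deleting the second row leaves the first row, where
  from the second column on the sums contain both \<open>a 1\<close> and \<open>a 2\<close>, so that these two parts act as a
  single one.\<close>
lemma det_B_mat_rec:
  "det (B_mat (Suc (Suc k)) a) =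
     det (B_mat (Suc k) (\<lambda>i. a (Suc i))) / fact (a 1) -
     det (B_mat (Suc k) (\<lambda>i. if i = 1 then a 1 + a 2 else a (Suc i)))"
proof -
  let ?M = "B_mat (Suc (Suc k)) a"
  let ?m = "\<lambda>i. if i = 1 then a 1 + a 2 else a (Suc i)"
  have M: "?M \<in> carrier_mat (Suc (Suc k)) (Suc (Suc k))"
    by (simp add: B_mat_def)
  have "det ?M = (\<Sum>i<Suc (Suc k). ?M $$ (i, 0) * cofactor ?M i 0)"
    by (rule laplace_expansion_column[OF M]) simp
  also have "\<dots> = (\<Sum>i\<in>{0, 1}. ?M $$ (i, 0) * cofactor ?M i 0)"
    by (rule sum.mono_neutral_right) (auto simp: B_mat_def b_entry_def)
  also have "\<dots> = det (mat_delete ?M 0 0) / fact (a 1) - det (mat_delete ?M 1 0)"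
    by (simp add: cofactor_def B_mat_def b_entry_def)
  also have "mat_delete ?M 0 0 = B_mat (Suc k) (\<lambda>i. a (Suc i))"
    by (rule eq_matI) (auto simp: mat_delete_def B_mat_def b_entry_Suc)
  also have "mat_delete ?M 1 0 = B_mat (Suc k) ?m"
  proof (rule eq_matI)
    fix i j assume "i < dim_row (B_mat (Suc k) ?m)" "j < dim_col (B_mat (Suc k) ?m)"
    then have ij: "i < Suc k" "j < Suc k" by (auto simp: B_mat_def)
    show "mat_delete ?M 1 0 $$ (i, j) = B_mat (Suc k) ?m $$ (i, j)"
    proof (cases i)
      case 0
      have "(\<Sum>l=1..Suc (Suc j). a l) = a 1 + a 2 + (\<Sum>l=2..Suc j. a (Suc l))"
        by (simp add: sum.atLeast_Suc_atMost numeral_2_eq_2 sum.shift_bounds_cl_Suc_ivl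
            del: sum.cl_ivl_Suc)
      also have "\<dots> = (\<Sum>l=1..Suc j. ?m l)"
        by (simp add: sum.atLeast_Suc_atMost numeral_2_eq_2 del: sum.cl_ivl_Suc)
      finally show ?thesis
        using ij 0 by (simp add: mat_delete_def B_mat_def b_entry_def)
    next
      case (Suc i')
      have "b_entry a (Suc (i + 1)) (Suc (j + 1)) = b_entry ?m (i + 1) (j + 1)"
        unfolding b_entry_Suc by (rule b_entry_cong) (use Suc in auto)
      then show ?thesis
        using ij Suc by (simp add: mat_delete_def B_mat_def)
    qed
  qed (simp_all add: B_mat_def)
  finally show ?thesis .
qed

text \<open>The determinant for a tuple given as a list; lists make the recursion an instance of list
  manipulation. List positions start at 0 and the indices of the tuple at 1.\<close>
definition det_parts :: "nat list \<Rightarrow> real" where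
  "det_parts as = det (B_mat (length as) (\<lambda>i. as ! (i - 1)))"

lemma det_parts_single: "det_parts [n] = 1 / fact n"
  unfolding det_parts_def by (subst det_single) (auto simp: B_mat_def b_entry_def)

lemma det_parts_rec:
  "det_parts (p # q # as) = det_parts (q # as) / fact p - det_parts ((p + q) # as)"
proof -
  have "B_mat (Suc (length as)) (\<lambda>i. (p # q # as) ! (Suc i - 1))
      = B_mat (Suc (length as)) (\<lambda>i. (q # as) ! (i - 1))"
    by (rule B_mat_cong) (auto simp: nth_Cons')
  moreover have "B_mat (Suc (length as)) (\<lambda>i. if i = 1 then (p # q # as) ! (1 - 1) + (p # q # as) ! (2 - 1)
        else (p # q # as) ! (Suc i - 1))
      = B_mat (Suc (length as)) (\<lambda>i. ((p + q) # as) ! (i - 1))"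
    by (rule B_mat_cong) (auto simp: nth_Cons')
  ultimately show ?thesis
    using det_B_mat_rec[of "length as" "\<lambda>i. (p # q # as) ! (i - 1)"]
    by (simp add: det_parts_def)
qed

section \<open>MacMahon's formula\<close>

text \<open>Both sides satisfy the same recursion on the number of parts, with the factorials turning
  \<open>1 / p!\<close> into the binomial coefficient that counts the choices of the first \<open>p\<close> letters. As \<open>A\<close> is
  arbitrary, the induction hypothesis applies to the complement of each choice and shows that its
  count depends on its size only.\<close>
lemma card_arrangements:
  fixes A :: "'a::linorder set"
  assumes "finite A" "as \<noteq> []" "\<And>p. p \<in> set as \<Longrightarrow> p > 0" "sum_list as = card A"
  shows "real (card (arrangements A as)) = fact (card A) * det_parts as"
  using assms
proof (induction "length as" arbitrary: A as rule: less_induct)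
  case less
  show ?case
  proof (cases as rule: run_lengths.cases)
    case 1
    with less.prems show ?thesis by simp
  next
    case (2 n)
    with less.prems show ?thesis
      using card_arrangements_single[of A n] by (simp add: det_parts_single)
  next
    case (3 p q bs)
    have pq: "p > 0" "q > 0" and n: "card A = p + (q + sum_list bs)"
      using less.prems 3 by auto
    let ?n = "card A"
    have rest: "real (card (arrangements (A - S) (q # bs))) = fact (?n - p) * det_parts (q # bs)"
      if "S \<subseteq> A" "card S = p" for S
    proof -
      have "card (A - S) = ?n - p"
        using that less.prems(1) by (simp add: card_Diff_subset finite_subset)
      then show ?thesis
        using less.hyps[of "q # bs" "A - S"] less.prems 3 n by auto
    qed
    have merged: "real (card (arrangements A ((p + q) # bs))) = fact ?n * det_parts ((p + q) # bs)"
      using less.hyps[of "(p + q) # bs" A] less.prems 3 n by auto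
    have "card (arrangements A (p # q # bs)) + card (arrangements A ((p + q) # bs))
        = card (arrangements A (p # q # bs) \<union> arrangements A ((p + q) # bs))"
      by (rule card_Un_disjoint[symmetric]) (auto simp: arrangements_def)
    also have "\<dots> = card (SIGMA S:{S. S \<subseteq> A \<and> card S = p}. arrangements (A - S) (q # bs))"
      using bij_betw_same_card[OF arrangements_split[OF less.prems(1) pq]] by simp
    also have "\<dots> = (\<Sum>S | S \<subseteq> A \<and> card S = p. card (arrangements (A - S) (q # bs)))"
      using less.prems(1) by simp
    finally have "real (card (arrangements A (p # q # bs)) + card (arrangements A ((p + q) # bs)))
        = real (\<Sum>S | S \<subseteq> A \<and> card S = p. card (arrangements (A - S) (q # bs)))"
      by (rule arg_cong)
    then have "real (card (arrangements A (p # q # bs))) + real (card (arrangements A ((p + q) # bs)))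
        = (\<Sum>S | S \<subseteq> A \<and> card S = p. real (card (arrangements (A - S) (q # bs))))"
      by (simp only: of_nat_add of_nat_sum)
    also have "\<dots> = real (?n choose p) * (fact (?n - p) * det_parts (q # bs))"
      using rest n_subsets[OF less.prems(1), of p] by simp
    also have "\<dots> = fact ?n * (det_parts (q # bs) / fact p)"
      using n by (simp add: binomial_fact)
    finally show ?thesis
      using merged by (simp add: 3 det_parts_rec algebra_simps)
  qed
qed

section \<open>From permutations and tuples to lists\<close>

lemma bij_betw_word:
  "bij_betw (\<lambda>\<sigma>. map \<sigma> [1..<Suc n]) {\<sigma>. \<sigma> permutes {1..n}} (permutations_of_set {1..n})"
proof -
  let ?f = "\<lambda>\<sigma> :: nat \<Rightarrow> nat. map \<sigma> [1..<Suc n]"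
  have inj: "inj_on ?f {\<sigma>. \<sigma> permutes {1..n}}"
  proof (rule inj_onI)
    fix \<sigma> \<tau> assume st: "\<sigma> \<in> {\<sigma>. \<sigma> permutes {1..n}}" "\<tau> \<in> {\<sigma>. \<sigma> permutes {1..n}}" "?f \<sigma> = ?f \<tau>"
    have "\<sigma> i = \<tau> i" if "i \<in> {1..n}" for i
      using st(3) that unfolding map_eq_conv by (auto simp del: upt_Suc)
    moreover have "\<sigma> i = \<tau> i" if "i \<notin> {1..n}" for i
      using st(1,2) that by (simp add: permutes_not_in)
    ultimately show "\<sigma> = \<tau>"
      by blast
  qed
  have sub: "?f ` {\<sigma>. \<sigma> permutes {1..n}} \<subseteq> permutations_of_set {1..n}"
  proof (rule image_subsetI)
    fix \<sigma> assume "\<sigma> \<in> {\<sigma>. \<sigma> permutes {1..n}}"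
    then have p: "\<sigma> permutes {1..n}" by simp
    have "set [1..<Suc n] = {1..n}" by auto
    with permutes_image[OF p] permutes_inj_on[OF p]
    show "?f \<sigma> \<in> permutations_of_set {1..n}"
      by (intro permutations_of_setI) (simp_all add: distinct_map del: upt_Suc)
  qed
  \<comment> \<open>Both sets have \<open>n!\<close> elements, so injectivity is enough.\<close>
  have "card (?f ` {\<sigma>. \<sigma> permutes {1..n}}) = card (permutations_of_set {1..n})"
    using inj by (simp add: card_image card_permutations[of _ n])
  then have "?f ` {\<sigma>. \<sigma> permutes {1..n}} = permutations_of_set {1..n}"
    using sub by (intro card_subset_eq) auto
  with inj show ?thesis by (simp add: bij_betw_def)
qed

lemma card_descents_word:
  "card (descents n \<sigma>) + length (run_lengths (map \<sigma> [1..<Suc n])) = n"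
proof -
  let ?w = "map \<sigma> [1..<Suc n]"
  have "descents n \<sigma> = Suc ` {i. Suc i < length ?w \<and> ?w ! i > ?w ! Suc i}"
  proof (rule Set.set_eqI)
    fix i
    show "i \<in> descents n \<sigma> \<longleftrightarrow> i \<in> Suc ` {i. Suc i < length ?w \<and> ?w ! i > ?w ! Suc i}"
      by (cases i) (auto simp: descents_def image_iff simp del: upt_Suc)
  qed
  then show ?thesis
    using card_descents_plus_runs[of ?w] by (simp add: card_image del: upt_Suc)
qed

lemma bij_betw_tuples:
  "bij_betw (\<lambda>a. map a [1..<Suc k]) (tuples k n)
    {as. length as = k \<and> (\<forall>p\<in>set as. p > 0) \<and> sum_list as = n}"
proof (rule bij_betw_byWitness[where f' = "\<lambda>as. restrict (\<lambda>i. as ! (i - 1)) {1..k}"])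
  show "\<forall>a\<in>tuples k n. restrict (\<lambda>i. map a [1..<Suc k] ! (i - 1)) {1..k} = a"
    by (auto simp: tuples_def PiE_def extensional_def fun_eq_iff simp del: upt_Suc)
  show "\<forall>as\<in>{as. length as = k \<and> (\<forall>p\<in>set as. p > 0) \<and> sum_list as = n}.
      map (restrict (\<lambda>i. as ! (i - 1)) {1..k}) [1..<Suc k] = as"
    by (auto intro!: nth_equalityI simp del: upt_Suc)
  show "(\<lambda>a. map a [1..<Suc k]) ` tuples k n
      \<subseteq> {as. length as = k \<and> (\<forall>p\<in>set as. p > 0) \<and> sum_list as = n}"
    by (auto simp: tuples_def PiE_def Pi_def interv_sum_list_conv_sum_set_nat
        atLeastLessThanSuc_atLeastAtMost Suc_le_eq simp del: upt_Suc)
  show "(\<lambda>as. restrict (\<lambda>i. as ! (i - 1)) {1..k}) `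
      {as. length as = k \<and> (\<forall>p\<in>set as. p > 0) \<and> sum_list as = n} \<subseteq> tuples k n"
  proof (rule image_subsetI)
    fix as :: "nat list"
    assume "as \<in> {as. length as = k \<and> (\<forall>p\<in>set as. p > 0) \<and> sum_list as = n}"
    then have as: "length as = k" "\<And>p. p \<in> set as \<Longrightarrow> p > 0" "sum_list as = n" by auto
    have "(\<Sum>i=1..k. as ! (i - 1)) = (\<Sum>i<k. as ! i)"
      by (rule sum.reindex_bij_witness[of _ Suc "\<lambda>i. i - 1"]) auto
    also have "\<dots> = n"
      using as by (simp add: sum_list_sum_nth atLeast0LessThan)
    finally show "restrict (\<lambda>i. as ! (i - 1)) {1..k} \<in> tuples k n"
      using as by (auto simp: tuples_def Suc_le_eq)
  qed
qed

section \<open>Eulerian numbers as sums of determinants\<close>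

text \<open>Sort the permutations with \<open>k\<close> runs by their run lengths and apply MacMahon's formula to each
  class.\<close>
theorem theorem5p3:
  fixes d k :: nat
  assumes "k \<ge> 1"
  shows "real (eulerian (d + k) d) =
    (\<Sum>a \<in> tuples k (d + k). fact (d + k) * det (B_mat k a))"
proof -
  let ?n = "d + k"
  let ?C = "{as. length as = k \<and> (\<forall>p\<in>set as. p > 0) \<and> sum_list as = ?n}"
  let ?W = "{xs \<in> permutations_of_set {1..?n}. length (run_lengths xs) = k}"
  have desc: "card (descents ?n \<sigma>) = d \<longleftrightarrow> length (run_lengths (map \<sigma> [1..<Suc ?n])) = k" for \<sigma>
    using card_descents_word[of ?n \<sigma>] by linarith
  have "bij_betw (\<lambda>\<sigma>. map \<sigma> [1..<Suc ?n])
      {\<sigma> \<in> {\<sigma>. \<sigma> permutes {1..?n}}. card (descents ?n \<sigma>) = d} ?W"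
    by (rule bij_betw_Collect[OF bij_betw_word]) (simp only: desc)
  then have "eulerian ?n d = card ?W"
    unfolding eulerian_def by (simp add: bij_betw_same_card del: upt_Suc)
  also have "?W = (\<Union>as\<in>?C. arrangements {1..?n} as)"
  proof -
    have "run_lengths xs \<in> ?C" if "xs \<in> ?W" for xs
      using that run_lengths_pos[of _ xs] sum_list_run_lengths[of xs]
      by (auto simp: length_finite_permutations_of_set)
    then show ?thesis by (auto simp: arrangements_def)
  qed
  also have "card \<dots> = (\<Sum>as\<in>?C. card (arrangements {1..?n} as))"
  proof (rule card_UN_disjoint)
    show "finite ?C"
    proof (rule finite_subset)
      show "?C \<subseteq> {as. set as \<subseteq> {..?n} \<and> length as = k}"
      proof (rule subsetI)
        fix as assume "as \<in> ?C"
        then show "as \<in> {as. set as \<subseteq> {..?n} \<and> length as = k}"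
          using member_le_sum_list[of _ as] by auto
      qed
    qed (simp add: finite_lists_length_eq)
  qed (auto simp: arrangements_def)
  finally have "real (eulerian ?n d) = (\<Sum>as\<in>?C. real (card (arrangements {1..?n} as)))"
    by simp
  also have "\<dots> = (\<Sum>as\<in>?C. fact ?n * det_parts as)"
  proof (rule sum.cong[OF refl])
    fix as assume as: "as \<in> ?C"
    then have "as \<noteq> []" using assms by auto
    with as show "real (card (arrangements {1..?n} as)) = fact ?n * det_parts as"
      using card_arrangements[of "{1..?n}" as] by auto
  qed
  also have "\<dots> = (\<Sum>a\<in>tuples k ?n. fact ?n * det_parts (map a [1..<Suc k]))"
    by (rule sum.reindex_bij_betw[OF bij_betw_tuples, symmetric])
  also have "\<dots> = (\<Sum>a\<in>tuples k ?n. fact ?n * det (B_mat k a))"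
  proof (rule sum.cong[OF refl])
    fix a
    have "B_mat k (\<lambda>i. map a [1..<Suc k] ! (i - 1)) = B_mat k a"
      by (rule B_mat_cong) (auto simp del: upt_Suc)
    then show "fact ?n * det_parts (map a [1..<Suc k]) = fact ?n * det (B_mat k a)"
      by (simp add: det_parts_def del: upt_Suc)
  qed
  finally show ?thesis .
qed

end
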